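(* Let $f(x)=x\sin\frac{1}{x}$ for $x\in(0,\infty)$. Then $$|f(y)-f(x)|\leq\sqrt{2|y-x|}\qquad\text{for all } x,y\in(0,\infty).$$ *)

theory Defs
  imports "HOL-Analysis.Analysis"
begin

end

theory Submission
  imports Defs
begin

text \<open>
  With \<open>a = 1/x\<close>, \<open>b = 1/y\<close>, \<open>b < a\<close>, the claim reads
  \<open>(a sin b - b sin a)^2 \<le> 2 a b (a - b)\<close>.
  Put \<open>d = (a - b)/2\<close> and \<open>p = a b\<close>. Cauchy--Schwarz, applied after expanding around the midpoint
  of \<open>a\<close> and \<open>b\<close>, bounds the left-hand side by \<open>4 (d^2 + p sin^2 d)\<close>, which suffices unless \<open>p\<close>
  is small. If \<open>p\<close> is small and \<open>d \<le> 1\<close>, it is enough that \<open>sin u / u\<close> is Lipschitz with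
  constant \<open>1/2\<close>; if \<open>d \<ge> 1\<close>, then \<open>b\<close> is small and the lower bound \<open>sin u / u \<ge> - 0.22\<close> suffices.
\<close>

section \<open>Polynomial and linear upper bounds for sine\<close>

lemma sin_le_quintic:
  fixes x :: real
  assumes "0 \<le> x"
  shows "sin x \<le> x - x^3 / 6 + x^5 / 120"
proof -
  have "\<bar>sin x - (\<Sum>m<5. sin_coeff m * x ^ m)\<bar> \<le> inverse (fact 5) * \<bar>x\<bar> ^ 5"
    by (rule Maclaurin_sin_bound)
  moreover have "(\<Sum>m<5. sin_coeff m * x ^ m) = x - x^3 / 6"
  proof -
    have "{..<5::nat} = {0, 1, 2, 3, 4}" by auto
    then show ?thesis by (simp add: sin_coeff_def fact_numeral)
  qed
  moreover have "inverse (fact 5) * \<bar>x\<bar> ^ 5 = x^5 / 120"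
    using assms by (simp add: eval_nat_numeral fact_reduce)
  ultimately show ?thesis by linarith
qed

lemma sin_le_cubic:
  fixes x :: real
  assumes "0 \<le> x" "x \<le> v"
  shows "sin x \<le> x - (1 / 6 - v\<^sup>2 / 120) * x^3"
proof -
  have "x\<^sup>2 \<le> v\<^sup>2" using assms by (simp add: power_mono)
  then have "x\<^sup>2 * x^3 \<le> v\<^sup>2 * x^3" using assms by (intro mult_right_mono) auto
  then show ?thesis using sin_le_quintic[OF assms(1)]
    by (simp add: field_simps eval_nat_numeral)
qed

text \<open>Both \<open>x^3\<close> and \<open>x^4\<close> are linearised below: the cubic by its tangent at \<open>c\<close>,
  the quartic as a function of \<open>x^2\<close> by its chord.\<close>

lemma cube_ge_tangent:
  fixes x c :: real
  assumes "0 \<le> x" "0 \<le> c"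
  shows "3 * c\<^sup>2 * x - 2 * c^3 \<le> x^3"
proof -
  have "0 \<le> (x - c)\<^sup>2 * (x + 2 * c)" using assms by simp
  then show ?thesis by (simp add: algebra_simps eval_nat_numeral)
qed

text \<open>In the middle ranges of \<open>d\<close> and \<open>b\<close> both
  \<open>sin x \<le> x\<close> and \<open>sin x \<le> 1\<close> are too weak. A linear bound there
  turns the remaining estimates into cubic polynomial inequalities.\<close>

lemma sin_le_line:
  fixes x :: real
  assumes "9/10 \<le> x" "x \<le> 7/5"
  shows "sin x \<le> 9/25 * x + 101/200"
proof -
  have "(9/10)\<^sup>2 \<le> x\<^sup>2" "x\<^sup>2 \<le> (7/5)\<^sup>2" using assms by (simp_all add: power_mono del: power_divide)
  then have "0 \<le> (x\<^sup>2 - (9/10)\<^sup>2) * ((7/5)\<^sup>2 - x\<^sup>2)" by simp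
  then have "x^4 \<le> 277/100 * x\<^sup>2 - 3969/2500"
    by (simp add: algebra_simps eval_nat_numeral)
  then have "x * x^4 \<le> x * (277/100 * x\<^sup>2 - 3969/2500)" using assms by (intro mult_left_mono) auto
  then have "x^5 \<le> 277/100 * x^3 - 3969/2500 * x" by (simp add: algebra_simps eval_nat_numeral)
  \<comment> \<open>Once the quintic term is absorbed, the upper bound is a concave cubic;
    \<open>603/500\<close> is close to the point where its slope is \<open>9/25\<close>.\<close>
  moreover have "3 * (603/500)\<^sup>2 * x - 2 * (603/500)^3 \<le> x^3" using assms by (intro cube_ge_tangent) auto
  moreover have "sin x \<le> x - x^3 / 6 + x^5 / 120" using assms by (intro sin_le_quintic) simp
  ultimately show ?thesis using assms by (simp add: power_divide)
qed

section \<open>Lower bound and Lipschitz constant for \<open>sin u / u\<close>\<close>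

text \<open>The minimum of \<open>sin u / u\<close> is about -0.2172, near \<open>u = 4.493\<close>,
  so \<open>11/50\<close> leaves little room. Beyond \<open>50/11\<close> the bound
  \<open>-1 \<le> sin a\<close> suffices; between \<open>pi\<close> and \<open>50/11\<close>,
  shifting by \<open>pi\<close> leaves an upper bound for sine.\<close>

lemma sin_ge_minus_linear:
  fixes a :: real
  assumes "0 \<le> a"
  shows "- (11/50 * a) \<le> sin a"
proof -
  consider "a \<le> pi" | "pi \<le> a" "a \<le> 50/11" | "50/11 \<le> a" by linarith
  then show ?thesis
  proof cases
    case 1
    then show ?thesis using assms sin_ge_zero[of a] by simp
  next
    case 2
    define t where "t = a - pi"
    have pi: "3141/1000 \<le> pi" using pi_approx by simp
    have t: "0 \<le> t" "t \<le> 141/100" using 2 pi by (simp_all add: t_def)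
    have "sin t \<le> t - (1 / 6 - (141/100)\<^sup>2 / 120) * t^3" using t by (rule sin_le_cubic)
    \<comment> \<open>The tangent point \<open>329/250\<close> makes the slope of the resulting line
      nearly \<open>11/50\<close>; the constant \<open>691/1000\<close> below stays under
      \<open>11/50 * pi\<close>.\<close>
    moreover have "3 * (329/250)\<^sup>2 * t - 2 * (329/250)^3 \<le> t^3" using t by (intro cube_ge_tangent) auto
    ultimately have "sin t \<le> 11/50 * t + 691/1000" using t by (simp add: eval_nat_numeral)
    moreover have "sin a = - sin t" by (simp add: t_def sin_diff)
    ultimately show ?thesis using pi t_def by linarith
  next
    case 3
    then show ?thesis using sin_ge_minus_one[of a] by linarith
  qed
qed

text \<open>The derivative of \<open>sin u - u * cos u\<close> is \<open>u * sin u\<close>, of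
  absolute value at most \<open>u\<close>. The bound controls the derivative of
  \<open>sin u / u\<close>.\<close>

lemma abs_sin_minus_x_cos_le:
  fixes u :: real
  assumes "0 \<le> u"
  shows "\<bar>sin u - u * cos u\<bar> \<le> u\<^sup>2 / 2"
proof -
  have "0\<^sup>2 / 2 - (sin 0 - 0 * cos 0) \<le> u\<^sup>2 / 2 - (sin u - u * cos u)"
  proof (rule DERIV_nonneg_imp_nondecreasing[OF assms])
    fix x :: real assume x: "0 \<le> x" "x \<le> u"
    have "((\<lambda>x. x\<^sup>2 / 2 - (sin x - x * cos x)) has_real_derivative x * (1 - sin x)) (at x)"
      by (auto intro!: derivative_eq_intros simp: algebra_simps)
    then show "\<exists>y. ((\<lambda>x. x\<^sup>2 / 2 - (sin x - x * cos x)) has_real_derivative y) (at x) \<and> 0 \<le> y"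
      using x by (intro exI[of _ "x * (1 - sin x)"]) simp
  qed
  moreover have "0\<^sup>2 / 2 + (sin 0 - 0 * cos 0) \<le> u\<^sup>2 / 2 + (sin u - u * cos u)"
  proof (rule DERIV_nonneg_imp_nondecreasing[OF assms])
    fix x :: real assume x: "0 \<le> x" "x \<le> u"
    have "((\<lambda>x. x\<^sup>2 / 2 + (sin x - x * cos x)) has_real_derivative x * (1 + sin x)) (at x)"
      by (auto intro!: derivative_eq_intros simp: algebra_simps)
    moreover have "0 \<le> 1 + sin x" using sin_ge_minus_one[of x] by linarith
    ultimately show "\<exists>y. ((\<lambda>x. x\<^sup>2 / 2 + (sin x - x * cos x)) has_real_derivative y) (at x) \<and> 0 \<le> y"
      using x by (intro exI[of _ "x * (1 + sin x)"]) simp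
  qed
  ultimately show ?thesis unfolding abs_le_iff by simp
qed

lemma sinc_lipschitz:
  fixes a b :: real
  assumes "0 < b" "b < a"
  shows "\<bar>sin b / b - sin a / a\<bar> \<le> (a - b) / 2"
proof -
  have "\<exists>z. b < z \<and> z < a \<and> sin a / a - sin b / b = (a - b) * ((z * cos z - sin z) / z\<^sup>2)"
  proof (rule MVT2[OF assms(2)])
    fix x assume "b \<le> x" "x \<le> a"
    then show "((\<lambda>x. sin x / x) has_real_derivative (x * cos x - sin x) / x\<^sup>2) (at x)"
      using assms by (auto intro!: derivative_eq_intros simp: power2_eq_square algebra_simps)
  qed
  then obtain z where z: "b < z"
    "sin a / a - sin b / b = (a - b) * ((z * cos z - sin z) / z\<^sup>2)" by blast
  have "\<bar>(z * cos z - sin z) / z\<^sup>2\<bar> \<le> 1 / 2"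
    using abs_sin_minus_x_cos_le[of z] z assms
    by (simp add: abs_divide abs_minus_commute divide_le_eq)
  then have "(a - b) * \<bar>(z * cos z - sin z) / z\<^sup>2\<bar> \<le> (a - b) * (1 / 2)"
    using assms by (intro mult_left_mono) auto
  moreover have "\<bar>sin b / b - sin a / a\<bar> = (a - b) * \<bar>(z * cos z - sin z) / z\<^sup>2\<bar>"
    using z(2) assms by (metis abs_minus_commute abs_mult abs_of_pos diff_gt_0_iff_gt)
  ultimately show ?thesis by simp
qed

section \<open>The inequality in \<open>a\<close> and \<open>b\<close>, by cases on \<open>d\<close>
  and \<open>b\<close>\<close>

text \<open>With midpoint \<open>m\<close>, Lagrange's identity yields the bound
  \<open>d^2 * cos^2 d + m^2 * sin^2 d\<close>, up to the factor 4; then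
  \<open>m^2 - d^2 = b * (b + 2 * d)\<close>.\<close>

lemma cross_sin_sq_le:
  fixes b d :: real
  shows "((b + 2 * d) * sin b - b * sin (b + 2 * d))\<^sup>2 \<le> 4 * (d\<^sup>2 + b * (b + 2 * d) * (sin d)\<^sup>2)"
proof -
  define m where "m = b + d"
  have b: "b = m - d" and a: "b + 2 * d = m + d" by (simp_all add: m_def)
  let ?s = "sin m" and ?c = "cos m" and ?A = "d * cos d" and ?B = "m * sin d"
  have "(b + 2 * d) * sin b - b * sin (b + 2 * d) = 2 * (?s * ?A - ?c * ?B)"
    unfolding a unfolding b by (simp add: sin_add sin_diff algebra_simps)
  moreover have "(?s * ?A - ?c * ?B)\<^sup>2 + (?s * ?B + ?c * ?A)\<^sup>2 = (?s\<^sup>2 + ?c\<^sup>2) * (?A\<^sup>2 + ?B\<^sup>2)"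
    by algebra
  then have "(?s * ?A - ?c * ?B)\<^sup>2 \<le> ?A\<^sup>2 + ?B\<^sup>2"
    using zero_le_power2[of "?s * ?B + ?c * ?A"] unfolding sin_cos_squared_add mult_1 by linarith
  moreover have "?A\<^sup>2 + ?B\<^sup>2 = d\<^sup>2 + b * (b + 2 * d) * (sin d)\<^sup>2"
    unfolding a unfolding b power_mult_distrib cos_squared_eq
    by (simp add: power2_eq_square algebra_simps)
  ultimately show ?thesis
    by (simp add: power_mult_distrib del: right_diff_distrib_numeral)
qed

text \<open>The Lipschitz bound gives \<open>(p * d)^2\<close>, which is enough when
  \<open>p * d \<le> 4\<close>. Otherwise Cauchy-Schwarz leaves
  \<open>d^2 \<le> p * (d - sin^2 d)\<close>, which follows from
  \<open>d^3 \<le> 4 * (d - sin^2 d)\<close>.\<close>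

lemma cross_sin_sq_le_small:
  fixes b d :: real
  assumes "0 < b" "0 < d" "d \<le> 1"
  shows "((b + 2 * d) * sin b - b * sin (b + 2 * d))\<^sup>2 \<le> 4 * (b * (b + 2 * d)) * d"
proof -
  define a where "a = b + 2 * d"
  define p where "p = b * a"
  have pos: "0 < a" "0 < p" using assms by (simp_all add: a_def p_def)
  show ?thesis
  proof (cases "p * d \<le> 4")
    case True
    have "a * sin b - b * sin a = p * (sin b / b - sin a / a)"
      using assms pos by (simp add: p_def field_simps)
    then have "\<bar>a * sin b - b * sin a\<bar> = p * \<bar>sin b / b - sin a / a\<bar>"
      using pos by (simp add: abs_mult)
    also have "\<dots> \<le> p * d"
      using sinc_lipschitz[of b a] assms pos by (intro mult_left_mono) (auto simp: a_def)
    finally have "(a * sin b - b * sin a)\<^sup>2 \<le> (p * d)\<^sup>2"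
      using power_mono[of "\<bar>a * sin b - b * sin a\<bar>" "p * d" 2] by simp
    also have "\<dots> \<le> 4 * (p * d)"
      unfolding power2_eq_square using True pos assms by (intro mult_right_mono) auto
    finally show ?thesis by (simp add: p_def a_def mult.assoc)
  next
    case False
    have "sin d \<le> d - (1 / 6 - 1\<^sup>2 / 120) * d^3" using assms by (intro sin_le_cubic) auto
    then have "sin d \<le> d * (1 - 19/120 * d\<^sup>2)" by (simp add: algebra_simps eval_nat_numeral)
    moreover have "0 \<le> sin d" using assms pi_gt3 by (intro sin_ge_zero) auto
    ultimately have "(sin d)\<^sup>2 \<le> (d * (1 - 19/120 * d\<^sup>2))\<^sup>2" by (intro power_mono)
    also have "\<dots> = d\<^sup>2 * (1 - 19/120 * d\<^sup>2)\<^sup>2" by (simp add: power_mult_distrib)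
    also have "\<dots> \<le> d * (1 - d\<^sup>2 / 4)"
    proof (intro mult_mono)
      show "d\<^sup>2 \<le> d" using assms by (simp add: power2_eq_square mult_left_le)
      have q: "0 \<le> d\<^sup>2" "d\<^sup>2 \<le> 1" using assms by (simp_all add: power_le_one)
      then have "d\<^sup>2 * d\<^sup>2 \<le> d\<^sup>2 * 1" by (intro mult_left_mono)
      moreover have "(1 - 19/120 * d\<^sup>2)\<^sup>2 = 1 - 19/60 * d\<^sup>2 + 361/14400 * (d\<^sup>2 * d\<^sup>2)"
        by (simp add: field_simps power2_eq_square)
      ultimately show "(1 - 19/120 * d\<^sup>2)\<^sup>2 \<le> 1 - d\<^sup>2 / 4"
        using q by linarith
    qed (use assms in auto)
    finally have "d * d\<^sup>2 \<le> 4 * (d - (sin d)\<^sup>2)" by (simp add: algebra_simps)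
    moreover from this have "0 \<le> d - (sin d)\<^sup>2"
      using assms by (smt (verit) mult_nonneg_nonneg zero_le_power2)
    then have "4 * (d - (sin d)\<^sup>2) \<le> p * d * (d - (sin d)\<^sup>2)"
      using False by (intro mult_right_mono) auto
    ultimately have "d * d\<^sup>2 \<le> d * (p * (d - (sin d)\<^sup>2))" by (simp add: mult.left_commute mult.assoc)
    then have "d\<^sup>2 \<le> p * (d - (sin d)\<^sup>2)" using assms by simp
    then show ?thesis using cross_sin_sq_le[of b d]
      by (simp add: p_def a_def algebra_simps)
  qed
qed

text \<open>Cauchy-Schwarz reduces the claim to \<open>d^2 \<le> p * r\<close>. Since
  \<open>p\<close> increases with \<open>b\<close>, the worst case is \<open>b = 127/100\<close>,
  where \<open>p\<close> equals \<open>l\<close>.\<close>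

lemma cross_sin_sq_le_large_large:
  fixes b d :: real
  assumes "127/100 \<le> b" "1 \<le> d"
  shows "((b + 2 * d) * sin b - b * sin (b + 2 * d))\<^sup>2 \<le> 4 * (b * (b + 2 * d)) * d"
proof -
  define p where "p = b * (b + 2 * d)"
  define r where "r = d - (sin d)\<^sup>2"
  define l where "l = (127/100) * (127/100 + 2 * d)"
  have lp: "l \<le> p" unfolding p_def l_def using assms by (intro mult_mono) auto
  have "(sin d)\<^sup>2 \<le> 1" by (simp add: sin_squared_eq)
  then have r1: "d - 1 \<le> r" by (simp add: r_def)
  \<comment> \<open>The split at \<open>137/100\<close> is just above the positive root of
    \<open>l * (d - 1) - d^2\<close>, so beyond it \<open>sin^2 d \<le> 1\<close> is enough.\<close>
  have "d\<^sup>2 \<le> l * r"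
  proof (cases "d \<le> 137/100")
    case True
    have "sin d \<le> 9/25 * d + 101/200" using assms True by (intro sin_le_line) auto
    moreover have "0 \<le> sin d" using assms True pi_gt3 by (intro sin_ge_zero) auto
    ultimately have "(sin d)\<^sup>2 \<le> (9/25 * d + 101/200)\<^sup>2" by (intro power_mono)
    then have r: "d - (9/25 * d + 101/200)\<^sup>2 \<le> r" by (simp add: r_def)
    define s where "s = d - 1"
    have s: "0 \<le> s" "s \<le> 37/100" and d: "d = 1 + s" using assms True by (simp_all add: s_def)
    have s2: "s\<^sup>2 \<le> 37/100 * s" unfolding power2_eq_square using s by (intro mult_right_mono) auto
    have "s * s\<^sup>2 \<le> 37/100 * s\<^sup>2" using s by (intro mult_right_mono) auto
    then have s3: "s^3 \<le> 37/100 * s\<^sup>2" by (simp add: eval_nat_numeral)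
    have "l * (d - (9/25 * d + 101/200)\<^sup>2) - d\<^sup>2 = 18238559/400000000
        + 10299119/50000000 * s - 3625799/6250000 * s\<^sup>2 - 10287/31250 * s^3"
      unfolding l_def d by (simp add: field_simps eval_nat_numeral)
    then have "d\<^sup>2 \<le> l * (d - (9/25 * d + 101/200)\<^sup>2)"
      using s s2 s3 by linarith
    also have "\<dots> \<le> l * r" using r assms by (intro mult_left_mono) (auto simp: l_def)
    finally show ?thesis .
  next
    case False
    \<comment> \<open>This bounds \<open>d^2\<close> below by its tangent at \<open>137/100\<close>,
      making the final comparison linear.\<close>
    then have "0 \<le> (d - 137/100) * (d - 137/100)" by simp
    then have "137/50 * d - 18769/10000 \<le> d\<^sup>2"
      by (simp add: field_simps power2_eq_square)
    moreover have "l * (d - 1) - d\<^sup>2 = 77/50 * d\<^sup>2 - 9271/10000 * d - 16129/10000"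
      unfolding l_def by (simp add: field_simps power2_eq_square)
    ultimately have "d\<^sup>2 \<le> l * (d - 1)" using False by linarith
    also have "\<dots> \<le> l * r" using r1 assms by (intro mult_left_mono) (auto simp: l_def)
    finally show ?thesis .
  qed
  also have "\<dots> \<le> p * r" using lp r1 assms by (intro mult_right_mono) auto
  finally show ?thesis using cross_sin_sq_le[of b d]
    by (simp add: p_def r_def algebra_simps)
qed

text \<open>This is what the case of small \<open>b\<close> and \<open>d \<ge> 1\<close> needs after
  \<open>sin a\<close> is replaced by \<open>- (11/50 * a)\<close>; the factor \<open>b + 2\<close>
  is the value of \<open>a / d\<close> at \<open>d = 1\<close>, its maximum.\<close>

lemma sin_plus_linear_sq_le:
  fixes b :: real
  assumes "0 < b" "b \<le> 127/100"
  shows "(sin b + 11/50 * b)\<^sup>2 * (b + 2) \<le> 4 * b"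
proof -
  have s0: "0 \<le> sin b" using assms pi_gt3 by (intro sin_ge_zero) auto
  show ?thesis
  proof (cases "b \<le> 9/10")
    case True
    have "(sin b + 11/50 * b)\<^sup>2 \<le> (61/50 * b)\<^sup>2"
      using s0 sin_x_le_x[of b] assms by (intro power_mono) auto
    then have "(sin b + 11/50 * b)\<^sup>2 * (b + 2) \<le> (61/50 * b)\<^sup>2 * (b + 2)"
      using assms by (intro mult_right_mono) auto
    also have "\<dots> = b * ((61/50)\<^sup>2 * (b * (b + 2)))" by (simp add: power2_eq_square)
    also have "\<dots> \<le> b * ((61/50)\<^sup>2 * (9/10 * (9/10 + 2)))"
      using assms True by (intro mult_left_mono mult_mono) auto
    also have "\<dots> \<le> b * 4" using assms by (intro mult_left_mono) (auto simp: power2_eq_square)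
    finally show ?thesis by simp
  next
    case False
    have "sin b \<le> 9/25 * b + 101/200" using assms False by (intro sin_le_line) auto
    then have "(sin b + 11/50 * b)\<^sup>2 \<le> (29/50 * b + 101/200)\<^sup>2"
      using s0 assms by (intro power_mono) auto
    then have "(sin b + 11/50 * b)\<^sup>2 * (b + 2) \<le> (29/50 * b + 101/200)\<^sup>2 * (b + 2)"
      using assms by (intro mult_right_mono) auto
    also have "\<dots> \<le> 4 * b"
    proof -
      \<comment> \<open>The chord of the square between \<open>9/10\<close> and
        \<open>127/100\<close>; multiplied by \<open>b\<close> it also handles the cubic
        term.\<close>
      have chord: "b\<^sup>2 \<le> 217/100 * b - 1143/1000"
        proof -
        have "0 \<le> (b - 9/10) * (127/100 - b)" using assms False by simp
        also have "\<dots> = 217/100 * b - 1143/1000 - b\<^sup>2"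
          by (simp add: field_simps power2_eq_square)
        finally show ?thesis by simp
      qed
      have "b * b\<^sup>2 \<le> b * (217/100 * b - 1143/1000)" using chord assms by (intro mult_left_mono) auto
      then have "b^3 \<le> 217/100 * b\<^sup>2 - 1143/1000 * b"
        by (simp add: algebra_simps eval_nat_numeral)
      moreover have "(29/50 * b + 101/200)\<^sup>2 * (b + 2)
          = 841/2500 * b^3 + 6293/5000 * b\<^sup>2 + 57065/40000 * b + 10201/20000"
        by (simp add: field_simps eval_nat_numeral)
      ultimately show ?thesis using chord assms False by linarith
    qed
    finally show ?thesis .
  qed
qed

text \<open>The sign of \<open>M\<close> decides the method. A nonnegative \<open>M\<close> is
  bounded through the lower bound on \<open>sin a\<close>. For negative \<open>M\<close>,
  \<open>sin a - sin b \<le> 2 * d\<close> and \<open>0 \<le> sin b\<close> give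
  \<open>- M \<le> 2 * b * d\<close>, and \<open>b \<le> 2\<close> finishes.\<close>

lemma cross_sin_sq_le_large_small:
  fixes b d :: real
  assumes "0 < b" "b \<le> 127/100" "1 \<le> d"
  shows "((b + 2 * d) * sin b - b * sin (b + 2 * d))\<^sup>2 \<le> 4 * (b * (b + 2 * d)) * d"
proof -
  define a where "a = b + 2 * d"
  define M where "M = a * sin b - b * sin a"
  have pos: "0 < a" using assms by (simp add: a_def)
  have s0: "0 \<le> sin b" using assms pi_gt3 by (intro sin_ge_zero) auto
  have "M\<^sup>2 \<le> 4 * (b * a) * d"
  proof (cases "0 \<le> M")
    case True
    have "b * (- sin a) \<le> b * (11/50 * a)"
      using sin_ge_minus_linear[of a] pos assms by (intro mult_left_mono) auto
    then have "M \<le> a * (sin b + 11/50 * b)" by (simp add: M_def algebra_simps)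
    then have "M\<^sup>2 \<le> (a * (sin b + 11/50 * b))\<^sup>2" using True by (intro power_mono)
    then have "M\<^sup>2 * (b + 2) \<le> (a * (sin b + 11/50 * b))\<^sup>2 * (b + 2)"
      using assms by (intro mult_right_mono) auto
    also have "\<dots> = a\<^sup>2 * ((sin b + 11/50 * b)\<^sup>2 * (b + 2))" by (simp add: power_mult_distrib)
    also have "\<dots> \<le> a\<^sup>2 * (4 * b)"
      using sin_plus_linear_sq_le[OF assms(1,2)] by (intro mult_left_mono) auto
    also have "\<dots> = (4 * (b * a)) * a" by (simp add: power2_eq_square)
    also have "\<dots> \<le> (4 * (b * a)) * (d * (b + 2))"
    proof (intro mult_left_mono)
      have "1 * b \<le> d * b" using assms by (intro mult_right_mono) auto
      then show "a \<le> d * (b + 2)" by (simp add: a_def algebra_simps)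
    qed (use assms pos in auto)
    finally show ?thesis using assms by (simp flip: mult.assoc)
  next
    case False
    have "sin a - sin b = 2 * (sin d * cos (b + d))"
      by (simp add: sin_diff_sin a_def add_divide_distrib)
    also have "\<dots> \<le> 2 * \<bar>sin d * cos (b + d)\<bar>" by simp
    also have "\<dots> \<le> 2 * (\<bar>sin d\<bar> * 1)"
      unfolding abs_mult by (intro mult_left_mono) auto
    also have "\<dots> \<le> 2 * d" using abs_sin_x_le_abs_x[of d] assms by simp
    finally have "b * (sin a - sin b) \<le> b * (2 * d)"
      using assms by (intro mult_left_mono) (auto simp: a_def)
    moreover have "0 \<le> 2 * d * sin b" using s0 assms by simp
    ultimately have "- M \<le> 2 * (b * d)" by (simp add: M_def a_def algebra_simps)
    then have "(- M)\<^sup>2 \<le> (2 * (b * d))\<^sup>2" using False by (intro power_mono) auto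
    also have "\<dots> = (4 * b * d) * (b * d)" by (simp add: power2_eq_square)
    also have "\<dots> \<le> (4 * b * d) * a"
    proof (intro mult_left_mono)
      have "b * d \<le> 2 * d" using assms by (intro mult_right_mono) auto
      then show "b * d \<le> a" unfolding a_def using assms by linarith
    qed (use assms in auto)
    finally show ?thesis by (simp add: mult_ac)
  qed
  then show ?thesis by (simp add: M_def a_def)
qed

section \<open>Combining the cases and returning to \<open>x\<close> and \<open>y\<close>\<close>

lemma cross_sin_sq_le_mult_diff:
  fixes a b :: real
  assumes "0 < b" "b < a"
  shows "(a * sin b - b * sin a)\<^sup>2 \<le> 2 * (a * b) * (a - b)"
proof -
  define d where "d = (a - b) / 2"
  have a: "a = b + 2 * d" and d: "0 < d" using assms by (simp_all add: d_def field_simps)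
  have "((b + 2 * d) * sin b - b * sin (b + 2 * d))\<^sup>2 \<le> 4 * (b * (b + 2 * d)) * d"
    using cross_sin_sq_le_small[OF assms(1) d] cross_sin_sq_le_large_large[of b d]
      cross_sin_sq_le_large_small[OF assms(1), of d] by linarith
  then show ?thesis by (simp add: a mult_ac)
qed

lemma abs_x_sin_inverse_diff_le:
  fixes x y :: real
  assumes "0 < x" "x < y"
  shows "\<bar>y * sin (1 / y) - x * sin (1 / x)\<bar> \<le> sqrt (2 * \<bar>y - x\<bar>)"
proof (rule real_le_rsqrt)
  have "(1/x * sin (1/y) - 1/y * sin (1/x))\<^sup>2 \<le> 2 * (1/x * (1/y)) * (1/x - 1/y)"
    using assms by (intro cross_sin_sq_le_mult_diff) (auto simp: frac_less2)
  \<comment> \<open>Multiplying by \<open>(x * y)^2\<close> clears the reciprocals on both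
    sides.\<close>
  then have "(x * y)\<^sup>2 * (1/x * sin (1/y) - 1/y * sin (1/x))\<^sup>2
      \<le> (x * y)\<^sup>2 * (2 * (1/x * (1/y)) * (1/x - 1/y))"
    by (intro mult_left_mono) auto
  moreover have "(x * y)\<^sup>2 * (1/x * sin (1/y) - 1/y * sin (1/x))\<^sup>2
      = (y * sin (1/y) - x * sin (1/x))\<^sup>2"
    using assms by (simp flip: power_mult_distrib add: right_diff_distrib)
  moreover have "(x * y)\<^sup>2 * (2 * (1/x * (1/y)) * (1/x - 1/y)) = 2 * \<bar>y - x\<bar>"
    using assms by (simp add: field_simps power2_eq_square)
  ultimately show "\<bar>y * sin (1 / y) - x * sin (1 / x)\<bar>\<^sup>2 \<le> 2 * \<bar>y - x\<bar>" by simp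
qed

theorem theorem2p5:
  fixes f :: "real \<Rightarrow> real"
  assumes f: "\<And>x. x \<in> {0<..} \<Longrightarrow> f x = x * sin (1 / x)"
  shows "\<forall>x\<in>{0<..}. \<forall>y\<in>{0<..}. \<bar>f y - f x\<bar> \<le> sqrt (2 * \<bar>y - x\<bar>)"
proof (intro ballI)
  fix x y :: real assume xy: "x \<in> {0<..}" "y \<in> {0<..}"
  show "\<bar>f y - f x\<bar> \<le> sqrt (2 * \<bar>y - x\<bar>)"
    using abs_x_sin_inverse_diff_le[of x y] abs_x_sin_inverse_diff_le[of y x] xy f[OF xy(1)] f[OF xy(2)]
    by (cases x y rule: linorder_cases) (auto simp: abs_minus_commute)
qed

end
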